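(* Let $f$ be a real-valued function that is smooth ($C^\infty$) in a neighbourhood of a point $x_i\in\mathbb{R}$, with $f'(x_i)\neq 0$. For small $\Delta x>0$ put $f_{i+j}=f(x_i+j\Delta x)$, $j=-2,\dots,2$, and let $\omega_0,\omega_1,\omega_2$ be the WENO-UD5 nonlinear weights with exponent $p=1$ and $\epsilon=0$, i.e. $$\omega_k=\frac{\alpha_k}{\alpha_0+\alpha_1+\alpha_2},\qquad \alpha_k=d_k\left(1+\frac{\zeta}{\beta_k}\right),\qquad k=0,1,2,$$ where $d_0=\tfrac1{10}$, $d_1=\tfrac{6}{10}$, $d_2=\tfrac{3}{10}$ and $\beta_k$, $\zeta$ are the local and global smoothness indicators given in the context. Then, as $\Delta x\to0$, $$\omega_0=\tfrac{1}{10}+O(\Delta x^5),\qquad \omega_1=\tfrac{6}{10}+O(\Delta x^5),\qquad \omega_2=\tfrac{3}{10}+O(\Delta x^5).$$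
   Context: The local smoothness indicators (built from undivided differences) are $$\beta_0=\tfrac12\big((f_{i-1}-f_{i-2})^2+(f_i-f_{i-1})^2\big)+(f_i-2f_{i-1}+f_{i-2})^2,$$ $$\beta_1=\tfrac12\big((f_i-f_{i-1})^2+(f_{i+1}-f_i)^2\big)+(f_{i-1}-2f_i+f_{i+1})^2,$$ $$\beta_2=\tfrac12\big((f_{i+1}-f_i)^2+(f_{i+2}-f_{i+1})^2\big)+(f_{i+2}-2f_{i+1}+f_i)^2,$$ and the global smoothness indicator is $$\zeta=\Big|(f_{i-2}-2f_{i-1}+f_i)^2-2(f_{i-1}-2f_i+f_{i+1})^2+(f_i-2f_{i+1}+f_{i+2})^2\Big|.$$ The point $x_i$ and the function $f$ are fixed and the asymptotics are for $\Delta x\to0^+$; the weights are defined for all sufficiently small $\Delta x$. *)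

theory Defs
  imports "HOL-Analysis.Analysis" "HOL-Library.Landau_Symbols"
begin

text \<open>
  The derivatives are the iterates of \<^const>\<open>deriv\<close>. As the set is
  open, \<^const>\<open>deriv\<close> at a point of it depends only on the values there.
\<close>

definition smooth_on_open :: "(real \<Rightarrow> real) \<Rightarrow> real set \<Rightarrow> bool" where
  "smooth_on_open f U \<longleftrightarrow>
     open U \<and> (\<forall>n. \<forall>y\<in>U. (deriv ^^ n) f field_differentiable (at y))"

definition smooth_near :: "(real \<Rightarrow> real) \<Rightarrow> real \<Rightarrow> bool" where
  "smooth_near f x \<longleftrightarrow> (\<exists>U. x \<in> U \<and> smooth_on_open f U)"

text \<open>
  A stencil is a function \<open>u\<close> on integer offsets: \<open>u j\<close> stands for the value
  $f_{i+j}$, so that only offsets $-2,\dots,2$ are used below.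
\<close>

definition stencil :: "(real \<Rightarrow> real) \<Rightarrow> real \<Rightarrow> real \<Rightarrow> int \<Rightarrow> real" where
  "stencil f x h j = f (x + of_int j * h)"

text \<open>Quantities carrying a subscript are meaningful for subscripts 0, 1, 2 only.\<close>

definition ud5_d :: "nat \<Rightarrow> real" where
  "ud5_d k = [1/10, 6/10, 3/10] ! k"

definition ud5_beta :: "(int \<Rightarrow> real) \<Rightarrow> nat \<Rightarrow> real" where
  "ud5_beta u k =
     [1/2 * ((u (-1) - u (-2))^2 + (u 0 - u (-1))^2) + (u 0 - 2 * u (-1) + u (-2))^2,
      1/2 * ((u 0 - u (-1))^2 + (u 1 - u 0)^2) + (u (-1) - 2 * u 0 + u 1)^2,
      1/2 * ((u 1 - u 0)^2 + (u 2 - u 1)^2) + (u 2 - 2 * u 1 + u 0)^2] ! k"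

definition ud5_zeta :: "(int \<Rightarrow> real) \<Rightarrow> real" where
  "ud5_zeta u =
     \<bar>(u (-2) - 2 * u (-1) + u 0)^2 - 2 * (u (-1) - 2 * u 0 + u 1)^2
        + (u 0 - 2 * u 1 + u 2)^2\<bar>"

text \<open>Exponent $p = 1$ and $\epsilon = 0$.\<close>

definition ud5_alpha :: "(int \<Rightarrow> real) \<Rightarrow> nat \<Rightarrow> real" where
  "ud5_alpha u k = ud5_d k * (1 + ud5_zeta u / ud5_beta u k)"

definition ud5_omega :: "(int \<Rightarrow> real) \<Rightarrow> nat \<Rightarrow> real" where
  "ud5_omega u k = ud5_alpha u k / (ud5_alpha u 0 + ud5_alpha u 1 + ud5_alpha u 2)"

end

theory Submission
  imports Defs
begin

text \<open>
  Taylor expansion makes each \<open>\<beta>\<^sub>k\<close> equal to \<open>h\<^sup>2 f'(x)\<^sup>2 + O(h\<^sup>3)\<close>. With \<open>P, Q, R\<close> the three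
  consecutive second differences, which are \<open>O(h\<^sup>2)\<close>,
  \<open>P\<^sup>2 - 2Q\<^sup>2 + R\<^sup>2 = (R - 2Q + P)(R + Q) + (Q - P)(R - P)\<close>,
  where the fourth difference \<open>R - 2Q + P\<close> is \<open>O(h\<^sup>4)\<close> and the third differences are
  \<open>O(h\<^sup>3)\<close>; hence \<open>\<zeta> = O(h\<^sup>6)\<close>. Since the linear weights sum to 1, \<open>\<omega>\<^sub>k - d\<^sub>k\<close> only involves the
  differences \<open>\<zeta>/\<beta>\<^sub>k - \<zeta>/\<beta>\<^sub>j = \<zeta>(\<beta>\<^sub>j - \<beta>\<^sub>k)/(\<beta>\<^sub>k\<beta>\<^sub>j) = O(h\<^bsup>6+3-4\<^esup>)\<close>.
\<close>

section \<open>Taylor expansion with a uniform remainder bound\<close>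

text \<open>The Lagrange remainder contains the \<open>n\<close>-th derivative at an unknown
  intermediate point. That derivative is itself differentiable, hence continuous and bounded on a
  compact ball inside \<open>U\<close>, so one constant serves all \<open>y\<close>.\<close>

lemma smooth_near_taylor_bound:
  fixes f :: "real \<Rightarrow> real"
  assumes "smooth_near f x" and "n > 0"
  obtains C e where "e > 0"
    and "\<And>y. \<bar>y - x\<bar> \<le> e \<Longrightarrow>
           \<bar>f y - (\<Sum>m<n. (deriv ^^ m) f x / fact m * (y - x)^m)\<bar> \<le> C * \<bar>y - x\<bar>^n"
proof -
  from assms obtain U where U: "x \<in> U" "open U"
    and diff: "\<And>m y. y \<in> U \<Longrightarrow> (deriv ^^ m) f field_differentiable (at y)"
    by (auto simp: smooth_near_def smooth_on_open_def)
  obtain e where e: "e > 0" "cball x e \<subseteq> U"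
    using U open_contains_cball by blast
  have I: "y \<in> U" if "x - e \<le> y" "y \<le> x + e" for y
    using e that by (auto simp: cball_def dist_real_def subset_iff)
  have der: "((deriv ^^ m) f has_real_derivative (deriv ^^ Suc m) f y) (at y)"
    if "y \<in> U" for m y
    using diff[OF that, of m] by (simp add: field_differentiable_derivI)
  have "continuous_on (cball x e) ((deriv ^^ n) f)"
    using der e by (meson DERIV_isCont continuous_at_imp_continuous_on subsetD)
  then have "bounded ((deriv ^^ n) f ` cball x e)"
    by (intro compact_imp_bounded compact_continuous_image compact_cball)
  then obtain B where B: "\<And>y. y \<in> cball x e \<Longrightarrow> \<bar>(deriv ^^ n) f y\<bar> \<le> B"
    unfolding bounded_real by blast
  show thesis
  proof
    show "e > 0" by fact
    fix y assume y: "\<bar>y - x\<bar> \<le> e"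
    let ?T = "\<Sum>m<n. (deriv ^^ m) f x / fact m * (y - x)^m"
    show "\<bar>f y - ?T\<bar> \<le> B / fact n * \<bar>y - x\<bar>^n"
    \<comment> \<open>\<open>Taylor\<close> needs distinct points. At \<open>y = x\<close> both
      sides vanish because \<open>n > 0\<close>: only the constant term of the sum survives.\<close>
    proof (cases "y = x")
      case True
      obtain k where "n = Suc k" using assms(2) gr0_conv_Suc by blast
      with True show ?thesis by (simp add: sum.lessThan_Suc_shift)
    next
      case False
      have "\<exists>t. (if y < x then y < t \<and> t < x else x < t \<and> t < y) \<and>
          f y = ?T + (deriv ^^ n) f t / fact n * (y - x)^n"
      proof (rule Taylor)
        show "(deriv ^^ 0) f = f" by simp
        show "\<forall>m t. m < n \<and> x - e \<le> t \<and> t \<le> x + e \<longrightarrow>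
            ((deriv ^^ m) f has_real_derivative (deriv ^^ Suc m) f t) (at t)"
          using der I by blast
      qed (use assms(2) e(1) y False in auto)
      then obtain t where t: "if y < x then y < t \<and> t < x else x < t \<and> t < y"
        and eq: "f y - ?T = (deriv ^^ n) f t / fact n * (y - x)^n"
        by auto
      have "t \<in> cball x e"
        using t y by (auto simp: dist_real_def split: if_splits)
      then show ?thesis
        unfolding eq abs_mult power_abs
        by (intro mult_right_mono) (auto intro!: divide_right_mono B)
    qed
  qed
qed

text \<open>For fixed \<open>j\<close> the point \<open>x + j h\<close> eventually enters the ball
  of the Taylor bound; the factor \<open>\<bar>j\<bar>^n\<close> goes into the constant.\<close>

lemma stencil_taylor:
  assumes "smooth_near f x" and "n > 0"
  shows "(\<lambda>h. stencil f x h j - (\<Sum>m<n. (deriv ^^ m) f x / fact m * (of_int j * h)^m))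
           \<in> O[at_right 0](\<lambda>h. h^n)"
proof -
  obtain C e where e: "e > 0"
    and C: "\<And>y. \<bar>y - x\<bar> \<le> e \<Longrightarrow>
           \<bar>f y - (\<Sum>m<n. (deriv ^^ m) f x / fact m * (y - x)^m)\<bar> \<le> C * \<bar>y - x\<bar>^n"
    by (rule smooth_near_taylor_bound[OF assms]) (rule that)
  have "((\<lambda>h. \<bar>real_of_int j * h\<bar>) \<longlongrightarrow> 0) (at_right 0)"
    by (auto intro!: tendsto_eq_intros)
  then have "\<forall>\<^sub>F h in at_right 0. \<bar>real_of_int j * h\<bar> < e"
    using e by (rule order_tendstoD)
  then show ?thesis
  proof (intro bigoI[where c = "C * \<bar>of_int j\<bar>^n"], eventually_elim)
    case (elim h)
    then show ?case
      using C[of "x + of_int j * h"]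
      by (simp add: stencil_def abs_mult power_mult_distrib power_abs mult.assoc)
  qed
qed

section \<open>Orders of the finite differences of the stencil\<close>

lemma first_difference_bigo:
  assumes "smooth_near f x"
  shows "(\<lambda>h. stencil f x h (j + 1) - stencil f x h j - deriv f x * h) \<in> O[at_right 0](\<lambda>h. h^2)"
proof -
  define r where "r j h = stencil f x h j - (\<Sum>m<2. (deriv ^^ m) f x / fact m * (of_int j * h)^m)"
    for j h
  have r: "r j \<in> O[at_right 0](\<lambda>h. h^2)" for j
    unfolding r_def by (intro stencil_taylor[OF assms]) auto
  have "(\<lambda>h. r (j + 1) h - r j h) \<in> O[at_right 0](\<lambda>h. h^2)"
    by (intro sum_in_bigo r)
  moreover have "r (j + 1) h - r j h = stencil f x h (j + 1) - stencil f x h j - deriv f x * h" for h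
    by (simp add: r_def lessThan_nat_numeral algebra_simps)
  ultimately show ?thesis by simp
qed

lemma second_difference_bigo:
  assumes "smooth_near f x"
  shows "(\<lambda>h. stencil f x h (j + 1) - 2 * stencil f x h j + stencil f x h (j - 1))
           \<in> O[at_right 0](\<lambda>h. h^2)"
  using sum_in_bigo(2)[OF first_difference_bigo[OF assms, of j]
      first_difference_bigo[OF assms, of "j - 1"]]
  by (simp add: algebra_simps)

text \<open>The binomial weights 1, -3, 3, -1 annihilate polynomials of degree at most 2, so only
  the Taylor remainders \<open>r\<close> survive.\<close>

lemma third_difference_bigo:
  assumes "smooth_near f x"
  shows "(\<lambda>h. stencil f x h (j + 2) - 3 * stencil f x h (j + 1) + 3 * stencil f x h j
             - stencil f x h (j - 1)) \<in> O[at_right 0](\<lambda>h. h^3)"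
proof -
  let ?u = "stencil f x"
  \<comment> \<open>Opaque coefficients make the cancellation below a plain polynomial
    identity.\<close>
  define c where "c m = (deriv ^^ m) f x / fact m" for m
  define r where "r j h = ?u h j - (\<Sum>m<3. c m * (of_int j * h)^m)" for j h
  have r: "r j \<in> O[at_right 0](\<lambda>h. h^3)" for j
    unfolding r_def c_def by (intro stencil_taylor[OF assms]) auto
  have "(\<lambda>h. r (j + 2) h - 3 * r (j + 1) h + 3 * r j h - r (j - 1) h) \<in> O[at_right 0](\<lambda>h. h^3)"
    by (intro sum_in_bigo landau_o.big.cmult_in_iff[THEN iffD2] r) auto
  moreover have "r (j + 2) h - 3 * r (j + 1) h + 3 * r j h - r (j - 1) h
      = ?u h (j + 2) - 3 * ?u h (j + 1) + 3 * ?u h j - ?u h (j - 1)" for h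
    by (simp add: r_def lessThan_nat_numeral power2_eq_square power3_eq_cube algebra_simps)
  ultimately show ?thesis by simp
qed

text \<open>The weights 1, -4, 6, -4, 1 annihilate cubics in the same way.\<close>

lemma fourth_difference_bigo:
  assumes "smooth_near f x"
  shows "(\<lambda>h. stencil f x h (j + 2) - 4 * stencil f x h (j + 1) + 6 * stencil f x h j
             - 4 * stencil f x h (j - 1) + stencil f x h (j - 2)) \<in> O[at_right 0](\<lambda>h. h^4)"
proof -
  let ?u = "stencil f x"
  define c where "c m = (deriv ^^ m) f x / fact m" for m
  define r where "r j h = ?u h j - (\<Sum>m<4. c m * (of_int j * h)^m)" for j h
  have r: "r j \<in> O[at_right 0](\<lambda>h. h^4)" for j
    unfolding r_def c_def by (intro stencil_taylor[OF assms]) auto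
  have "(\<lambda>h. r (j + 2) h - 4 * r (j + 1) h + 6 * r j h - 4 * r (j - 1) h + r (j - 2) h)
          \<in> O[at_right 0](\<lambda>h. h^4)"
    by (intro sum_in_bigo landau_o.big.cmult_in_iff[THEN iffD2] r) auto
  moreover have "r (j + 2) h - 4 * r (j + 1) h + 6 * r j h - 4 * r (j - 1) h + r (j - 2) h
      = ?u h (j + 2) - 4 * ?u h (j + 1) + 6 * ?u h j - 4 * ?u h (j - 1) + ?u h (j - 2)" for h
    by (simp add: r_def lessThan_nat_numeral power2_eq_square power3_eq_cube algebra_simps)
  ultimately show ?thesis by simp
qed

section \<open>Orders of the smoothness indicators\<close>

text \<open>Bounding the three squares separately would give only \<open>h^4\<close>; the
  factorisation gains two orders.\<close>

lemma ud5_zeta_bigo: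
  assumes "smooth_near f x"
  shows "(\<lambda>h. ud5_zeta (stencil f x h)) \<in> O[at_right 0](\<lambda>h. h^6)"
proof -
  let ?u = "stencil f x"
  define P Q R where "P h = ?u h 0 - 2 * ?u h (-1) + ?u h (-2)"
    and "Q h = ?u h 1 - 2 * ?u h 0 + ?u h (-1)"
    and "R h = ?u h 2 - 2 * ?u h 1 + ?u h 0" for h
  note defs = P_def Q_def R_def
  have Q2: "Q \<in> O[at_right 0](\<lambda>h. h^2)" and R2: "R \<in> O[at_right 0](\<lambda>h. h^2)"
    using second_difference_bigo[OF assms, of 0] second_difference_bigo[OF assms, of 1]
    by (simp_all add: defs[abs_def])
  have QP: "(\<lambda>h. Q h - P h) \<in> O[at_right 0](\<lambda>h. h^3)"
    using third_difference_bigo[OF assms, of "-1"] by (simp add: defs algebra_simps)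
  have RQ: "(\<lambda>h. R h - Q h) \<in> O[at_right 0](\<lambda>h. h^3)"
    using third_difference_bigo[OF assms, of 0] by (simp add: defs algebra_simps)
  \<comment> \<open>Telescoping: \<open>R - P = (R - Q) + (Q - P)\<close>.\<close>
  have RP: "(\<lambda>h. R h - P h) \<in> O[at_right 0](\<lambda>h. h^3)"
    using sum_in_bigo(1)[OF RQ QP] by simp
  have S: "(\<lambda>h. R h - 2 * Q h + P h) \<in> O[at_right 0](\<lambda>h. h^4)"
    using fourth_difference_bigo[OF assms, of 0] by (simp add: defs algebra_simps)
  have "(\<lambda>h. (R h - 2 * Q h + P h) * (R h + Q h)) \<in> O[at_right 0](\<lambda>h. h^4 * h^2)"
    by (intro landau_o.big.mult S sum_in_bigo Q2 R2)
  moreover have "(\<lambda>h. (Q h - P h) * (R h - P h)) \<in> O[at_right 0](\<lambda>h. h^3 * h^3)"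
    by (intro landau_o.big.mult QP RP)
  ultimately have "(\<lambda>h. (R h - 2 * Q h + P h) * (R h + Q h) + (Q h - P h) * (R h - P h))
      \<in> O[at_right 0](\<lambda>h. h^6)"
    by (intro sum_in_bigo) (simp_all flip: power_add)
  moreover have "ud5_zeta (?u h)
      = \<bar>(R h - 2 * Q h + P h) * (R h + Q h) + (Q h - P h) * (R h - P h)\<bar>" for h
    unfolding ud5_zeta_def defs by (rule arg_cong[where f = abs]) algebra
  ultimately show ?thesis by simp
qed

text \<open>With \<open>b = f'(x) h\<close> and first difference \<open>b + D\<close>, the error is
  \<open>(b + D)^2 - b^2 = D (D + 2 b)\<close>, of order \<open>h^2 * h\<close>.\<close>

lemma first_difference_square_bigo:
  assumes "smooth_near f x"
  shows "(\<lambda>h. (stencil f x h (j + 1) - stencil f x h j)^2 - (deriv f x)^2 * h^2)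
           \<in> O[at_right 0](\<lambda>h. h^3)"
proof -
  define D where "D h = stencil f x h (j + 1) - stencil f x h j - deriv f x * h" for h
  have D: "D \<in> O[at_right 0](\<lambda>h. h^2)"
    using first_difference_bigo[OF assms] by (simp add: D_def[abs_def])
  have "(\<lambda>h. h^2 :: real) \<in> O[at_right 0](\<lambda>h. h)"
    by (intro bigoI[where c = 1] eventually_at_rightI[of 0 1])
       (auto simp: power2_eq_square mult_le_cancel_left1)
  then have "(\<lambda>h. D h + 2 * deriv f x * h) \<in> O[at_right 0](\<lambda>h. h)"
    using D by (intro sum_in_bigo) (auto intro: landau_o.big_trans)
  then have "(\<lambda>h. D h * (D h + 2 * deriv f x * h)) \<in> O[at_right 0](\<lambda>h. h^2 * h)"
    by (intro landau_o.big.mult D)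
  then show ?thesis
    by (simp add: D_def power2_eq_square power3_eq_cube algebra_simps)
qed

text \<open>The true order is \<open>h^4\<close>; it is weakened to match the error of the squared
  first differences.\<close>

lemma second_difference_square_bigo:
  assumes "smooth_near f x"
  shows "(\<lambda>h. (stencil f x h (j + 1) - 2 * stencil f x h j + stencil f x h (j - 1))^2)
           \<in> O[at_right 0](\<lambda>h. h^3)"
proof -
  have "(\<lambda>h. (stencil f x h (j + 1) - 2 * stencil f x h j + stencil f x h (j - 1))^2)
          \<in> O[at_right 0](\<lambda>h. (h^2)^2)"
    by (intro landau_o.big_power second_difference_bigo[OF assms])
  also have "(\<lambda>h. (h^2)^2 :: real) \<in> O[at_right 0](\<lambda>h. h^3)"
    by (intro bigoI[where c = 1] eventually_at_rightI[of 0 1])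
       (auto simp flip: power_mult intro!: power_decreasing)
  finally show ?thesis .
qed

text \<open>The factor 1/2 averages two squared first differences with the same leading term, so the
  average keeps that term, whatever \<open>k\<close> is.\<close>

lemma ud5_beta_bigo:
  assumes "smooth_near f x" and "k < 3"
  shows "(\<lambda>h. ud5_beta (stencil f x h) k - (deriv f x)^2 * h^2) \<in> O[at_right 0](\<lambda>h. h^3)"
proof -
  let ?u = "stencil f x"
  define E where "E j h = (?u h (j + 1) - ?u h j)^2 - (deriv f x)^2 * h^2" for j h
  define S where "S j h = (?u h (j + 1) - 2 * ?u h j + ?u h (j - 1))^2" for j h
  have E: "E j \<in> O[at_right 0](\<lambda>h. h^3)" and S: "S j \<in> O[at_right 0](\<lambda>h. h^3)" for j
    using first_difference_square_bigo[OF assms(1)] second_difference_square_bigo[OF assms(1)]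
    by (simp_all add: E_def[abs_def] S_def[abs_def])
  have *: "(\<lambda>h. 1/2 * (E i h + E j h) + S l h) \<in> O[at_right 0](\<lambda>h. h^3)" for i j l
    by (intro sum_in_bigo landau_o.big.cmult_in_iff[THEN iffD2] E S) auto
  consider "k = 0" | "k = 1" | "k = 2" using assms(2) by linarith
  then show ?thesis
  proof cases
    case 1
    then show ?thesis using *[of "-2" "-1" "-1"]
      by (simp add: ud5_beta_def E_def S_def algebra_simps)
  next
    case 2
    then show ?thesis using *[of "-1" 0 0]
      by (simp add: ud5_beta_def E_def S_def algebra_simps)
  next
    case 3
    then show ?thesis using *[of 0 1 1]
      by (simp add: ud5_beta_def E_def S_def algebra_simps)
  qed
qed

section \<open>Quotients of the indicators\<close>

text \<open>The error is of smaller order than \<open>c h^n\<close>, so \<open>g\<close> is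
  asymptotically equivalent to it; the lower half of the resulting \<Theta> bound can be
  inverted.\<close>

lemma inverse_bigo_of_leading_term:
  fixes g :: "real \<Rightarrow> real"
  assumes "(\<lambda>h. g h - c * h^n) \<in> O[at_right 0](\<lambda>h. h^Suc n)" and "c \<noteq> 0"
  shows "\<forall>\<^sub>F h in at_right 0. g h \<noteq> 0"
    and "(\<lambda>h. inverse (g h)) \<in> O[at_right 0](\<lambda>h. inverse (h^n))"
proof -
  have nz: "\<forall>\<^sub>F h::real in at_right 0. h^n \<noteq> 0"
    by (intro eventually_at_rightI[of 0 1]) auto
  have "(\<lambda>h. h^Suc n :: real) \<in> o[at_right 0](\<lambda>h. h^n)"
  proof (intro smalloI_tendsto)
    have "((\<lambda>h::real. h) \<longlongrightarrow> 0) (at_right 0)" by (intro tendsto_intros)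
    then show "((\<lambda>h::real. h^Suc n / h^n) \<longlongrightarrow> 0) (at_right 0)"
      by (rule Lim_transform_eventually)
         (auto intro!: eventually_at_rightI[of 0 1])
    show "\<forall>\<^sub>F h::real in at_right 0. h^n \<noteq> 0" by (fact nz)
  qed
  then have "(\<lambda>h. g h - c * h^n) \<in> o[at_right 0](\<lambda>h. c * h^n)"
    using assms by (simp add: landau_o.big_small_trans)
  then have "g \<sim>[at_right 0] (\<lambda>h. c * h^n)"
    by (simp add: asymp_equiv_altdef)
  then have "g \<in> \<Theta>[at_right 0](\<lambda>h. c * h^n)"
    by (rule asymp_equiv_imp_bigtheta)
  then have \<Theta>: "g \<in> \<Theta>[at_right 0](\<lambda>h. h^n)"
    using assms(2) by simp
  show g: "\<forall>\<^sub>F h in at_right 0. g h \<noteq> 0"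
    using eventually_nonzero_bigtheta[OF \<Theta>] nz by blast
  show "(\<lambda>h. inverse (g h)) \<in> O[at_right 0](\<lambda>h. inverse (h^n))"
    by (rule landau_o.big.inverse[OF nz g bigthetaD2[OF \<Theta>, unfolded bigomega_iff_bigo]])
qed

lemma ud5_ratio_difference_bigo:
  assumes "smooth_near f x" and "deriv f x \<noteq> 0" and "k < 3" and "l < 3"
  shows "(\<lambda>h. ud5_zeta (stencil f x h) / ud5_beta (stencil f x h) k
            - ud5_zeta (stencil f x h) / ud5_beta (stencil f x h) l) \<in> O[at_right 0](\<lambda>h. h^5)"
proof -
  define z b where "z h = ud5_zeta (stencil f x h)" and "b k h = ud5_beta (stencil f x h) k"
    for k h
  have z: "z \<in> O[at_right 0](\<lambda>h. h^6)"
    using ud5_zeta_bigo[OF assms(1)] by (simp add: z_def[abs_def])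
  have b: "(\<lambda>h. b k h - (deriv f x)^2 * h^2) \<in> O[at_right 0](\<lambda>h. h^3)" if "k < 3" for k
    using ud5_beta_bigo[OF assms(1) that] by (simp add: b_def)
  have inv: "\<forall>\<^sub>F h in at_right 0. b k h \<noteq> 0"
    "(\<lambda>h. inverse (b k h)) \<in> O[at_right 0](\<lambda>h. inverse (h^2))" if "k < 3" for k
    using inverse_bigo_of_leading_term[of "b k" "(deriv f x)^2" 2] b[OF that] assms(2) by auto
  \<comment> \<open>The common leading term cancels, which gains the order that lifts the final
    exponent from 4 to 5.\<close>
  have d: "(\<lambda>h. b l h - b k h) \<in> O[at_right 0](\<lambda>h. h^3)"
    using sum_in_bigo(2)[OF b[OF assms(4)] b[OF assms(3)]] by simp
  have "(\<lambda>h. z h * (b l h - b k h) * (inverse (b k h) * inverse (b l h)))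
      \<in> O[at_right 0](\<lambda>h. h^6 * h^3 * (inverse (h^2) * inverse (h^2)))"
    by (intro landau_o.big.mult z d inv assms)
  \<comment> \<open>The two expressions agree where both denominators are nonzero, hence
    eventually.\<close>
  also have "?this \<longleftrightarrow> (\<lambda>h. z h / b k h - z h / b l h)
      \<in> O[at_right 0](\<lambda>h. h^6 * h^3 * (inverse (h^2) * inverse (h^2)))"
    using inv(1)[OF assms(3)] inv(1)[OF assms(4)]
    by (intro landau_o.big.in_cong, eventually_elim) (simp add: field_simps)
  also have "O[at_right 0](\<lambda>h::real. h^6 * h^3 * (inverse (h^2) * inverse (h^2)))
      = O[at_right 0](\<lambda>h. h^5)"
    by (intro landau_o.big.cong)
       (auto intro!: eventually_at_rightI[of 0 1] simp: field_simps simp flip: power_add)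
  finally show ?thesis
    by (simp add: z_def b_def)
qed

section \<open>From the quotients to the weights\<close>

lemma ud5_beta_nonneg:
  assumes "k < 3"
  shows "ud5_beta u k \<ge> 0"
proof -
  consider "k = 0" | "k = 1" | "k = 2" using assms by linarith
  then show ?thesis by cases (simp_all add: ud5_beta_def)
qed

text \<open>Let \<open>s\<close> be the mean of the \<open>q l\<close> with weights
  \<open>ud5_d l\<close>. As these sum to 1,
  \<open>\<omega>\<^sub>k - d\<^sub>k = d\<^sub>k (q k - s) / (1 + s)\<close>, where
  \<open>q k - s\<close> is a convex combination of the differences
  \<open>q k - q l\<close>.\<close>

lemma ud5_omega_diff_le:
  fixes u :: "int \<Rightarrow> real"
  assumes "k < 3"
  defines "q \<equiv> \<lambda>l. ud5_zeta u / ud5_beta u l"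
  shows "\<bar>ud5_omega u k - ud5_d k\<bar> \<le> \<bar>q k - q 0\<bar> + \<bar>q k - q 1\<bar> + \<bar>q k - q 2\<bar>"
proof -
  define s where "s = ud5_d 0 * q 0 + ud5_d 1 * q 1 + ud5_d 2 * q 2"
  have d: "ud5_d 0 = 1/10" "ud5_d (Suc 0) = 6/10" "ud5_d 2 = 3/10"
    by (simp_all add: ud5_d_def)
  have q: "q l \<ge> 0" if "l < 3" for l
    using ud5_beta_nonneg[OF that] by (simp add: q_def ud5_zeta_def)
  have s0: "s \<ge> 0"
    using q[of 0] q[of 1] q[of 2] by (simp add: s_def d)
  have dk: "\<bar>ud5_d k\<bar> \<le> 1"
  proof -
    consider "k = 0" | "k = 1" | "k = 2" using assms(1) by linarith
    then show ?thesis by cases (simp_all add: ud5_d_def)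
  qed
  have \<alpha>: "ud5_alpha u l = ud5_d l * (1 + q l)" for l
    by (simp add: ud5_alpha_def q_def)
  have "ud5_alpha u 0 + ud5_alpha u 1 + ud5_alpha u 2 = 1 + s"
    by (simp add: \<alpha> s_def d field_simps)
  then have "ud5_omega u k = ud5_d k * (1 + q k) / (1 + s)"
    by (simp add: ud5_omega_def \<alpha>)
  then have "ud5_omega u k - ud5_d k = ud5_d k * ((q k - s) / (1 + s))"
    using s0 by (simp add: field_simps)
  then have "\<bar>ud5_omega u k - ud5_d k\<bar> \<le> 1 * \<bar>(q k - s) / (1 + s)\<bar>"
    using dk by (simp only: abs_mult) (intro mult_right_mono, auto)
  also have "\<dots> \<le> \<bar>q k - s\<bar>"
    using s0 by (simp add: field_simps mult_left_mono)
  also have "q k - s = 1/10 * (q k - q 0) + 6/10 * (q k - q 1) + 3/10 * (q k - q 2)"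
    by (simp add: s_def d field_simps)
  also have "\<bar>\<dots>\<bar> \<le> \<bar>q k - q 0\<bar> + \<bar>q k - q 1\<bar> + \<bar>q k - q 2\<bar>"
  proof -
    have "\<bar>1/10 * a + 6/10 * b + 3/10 * c\<bar> \<le> \<bar>a\<bar> + \<bar>b\<bar> + \<bar>c\<bar>" for a b c :: real
      by linarith
    then show ?thesis .
  qed
  finally show ?thesis .
qed

lemma ud5_omega_bigo:
  assumes "smooth_near f x" and "deriv f x \<noteq> 0" and "k < 3"
  shows "(\<lambda>h. ud5_omega (stencil f x h) k - ud5_d k) \<in> O[at_right 0](\<lambda>h. h^5)"
proof -
  define q where "q l h = ud5_zeta (stencil f x h) / ud5_beta (stencil f x h) l" for l h
  have "(\<lambda>h. ud5_omega (stencil f x h) k - ud5_d k)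
      \<in> O[at_right 0](\<lambda>h. \<bar>q k h - q 0 h\<bar> + \<bar>q k h - q 1 h\<bar> + \<bar>q k h - q 2 h\<bar>)"
    using ud5_omega_diff_le[OF assms(3)]
    by (intro bigoI[where c = 1] always_eventually) (auto simp: q_def)
  also have "(\<lambda>h. \<bar>q k h - q 0 h\<bar> + \<bar>q k h - q 1 h\<bar> + \<bar>q k h - q 2 h\<bar>)
      \<in> O[at_right 0](\<lambda>h. h^5)"
    using ud5_ratio_difference_bigo[OF assms(1-3)]
    by (intro sum_in_bigo) (simp_all add: q_def)
  finally show ?thesis .
qed

theorem mainTheorem1:
  fixes f :: "real \<Rightarrow> real" and x :: real
  assumes "smooth_near f x"
    and "deriv f x \<noteq> 0"
  shows "(\<lambda>h. ud5_omega (stencil f x h) 0 - 1/10) \<in> O[at_right 0](\<lambda>h. h^5)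
       \<and> (\<lambda>h. ud5_omega (stencil f x h) 1 - 6/10) \<in> O[at_right 0](\<lambda>h. h^5)
       \<and> (\<lambda>h. ud5_omega (stencil f x h) 2 - 3/10) \<in> O[at_right 0](\<lambda>h. h^5)"
  using ud5_omega_bigo[OF assms, of 0] ud5_omega_bigo[OF assms, of 1]
    ud5_omega_bigo[OF assms, of 2]
  by (simp add: ud5_d_def)

end
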